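(* Let $D$ be a digraph of order $n$, let $1 \le k \le n-1$, and let $C_1,\ldots,C_t$ be a topological order of the strongly connected components of $D$. The condensation digraph $\mathrm{CD}(F_k(D))$ is isomorphic to the directed acyclic graph whose vertex set is $V_k(|C_1|,\ldots,|C_t|)$ and which has an arc from $(k_1,\ldots,k_t)$ to $(k'_1,\ldots,k'_t)$ if and only if there are indices $i<j$ such that there is an $(i,j)$-move from $(k_1,\ldots,k_t)$ to $(k'_1,\ldots,k'_t)$ and there is an arc from $C_i$ to $C_j$ in $\mathrm{CD}(D)$.
   Context: A digraph $D$ has a finite vertex set $V(D)$ and a set $A(D)$ of arcs, which are ordered pairs of distinct vertices (both $(x,y)$ and $(y,x)$ may be arcs). For a digraph $D$ of order $n$ and $1 \le k \le n-1$, the $k$-token digraph $F_k(D)$ has as vertices all $k$-subsets of $V(D)$, and $(A,B)$ is an arc of $F_k(D)$ whenever $A\setminus B=\{a\}$, $B\setminus A=\{b\}$ and $(a,b)\in A(D)$. Strongly connected components are the maximal strongly connected subdigraphs; they are identified with their vertex sets. The condensation digraph $\mathrm{CD}(D)$ is obtained from $D$ by collapsing all vertices of each strongly connected component $C_i$ to a single vertex, also denoted $C_i$ (so for $i\neq j$ there is an arc from $C_i$ to $C_j$ in $\mathrm{CD}(D)$ iff $D$ has an arc from a vertex of $C_i$ to a vertex of $C_j$); it is acyclic. $C_1,\ldots,C_t$ is a topological order if every arc of $\mathrm{CD}(D)$ goes from some $C_i$ to some $C_j$ with $i<j$. For positive integers $c_1,\ldots,c_t$, $V_k(c_1,\ldots,c_t)$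 is the set of integer vectors $(k_1,\ldots,k_t)$ with $0\le k_i\le c_i$ for every $i$ and $\sum_{i=1}^t k_i=k$. There is an $(i,j)$-move from $(k_1,\ldots,k_t)$ to $(k'_1,\ldots,k'_t)$ if $k_\ell=k'_\ell$ for every $\ell\ne i,j$, $k'_i=k_i-1$ and $k'_j=k_j+1$. *)

theory Defs
  imports "Graph_Theory.Digraph_Component" "Graph_Theory.Digraph_Isomorphism"
begin

text \<open>
  A digraph (finite, without loops or parallel arcs, opposite arcs allowed) is a
  \<^const>\<open>pair_digraph\<close>.  Lists are indexed from 0, so the components
  \<open>C\<^sub>1, \<dots>, C\<^sub>t\<close> are \<open>Cs ! 0, \<dots>, Cs ! (t - 1)\<close>.
\<close>

definition token_digraph :: "nat \<Rightarrow> 'a pair_pre_digraph \<Rightarrow> 'a set pair_pre_digraph" where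
  "token_digraph k D =
    \<lparr> pverts = {A. A \<subseteq> pverts D \<and> card A = k},
      parcs = {(A, B). A \<subseteq> pverts D \<and> card A = k \<and> B \<subseteq> pverts D \<and> card B = k \<and>
                 (\<exists>a b. A - B = {a} \<and> B - A = {b} \<and> (a, b) \<in> parcs D)} \<rparr>"

definition strong_components :: "'a pair_pre_digraph \<Rightarrow> 'a set set" where
  "strong_components D = verts ` pre_digraph.sccs (with_proj D)"

definition condensation :: "'a pair_pre_digraph \<Rightarrow> 'a set pair_pre_digraph" where
  "condensation D =
    \<lparr> pverts = strong_components D,
      parcs = {(C, C'). C \<in> strong_components D \<and> C' \<in> strong_components D \<and> C \<noteq> C' \<and>
                 (\<exists>x\<in>C. \<exists>y\<in>C'. (x, y) \<in> parcs D)} \<rparr>"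

definition topological_order :: "'a pair_pre_digraph \<Rightarrow> 'a set list \<Rightarrow> bool" where
  "topological_order D Cs \<longleftrightarrow>
     distinct Cs \<and> set Cs = strong_components D \<and>
     (\<forall>(X, Y) \<in> parcs (condensation D). \<exists>i j. i < j \<and> j < length Cs \<and> X = Cs ! i \<and> Y = Cs ! j)"

definition bounded_vectors :: "nat \<Rightarrow> nat list \<Rightarrow> int list set" where
  "bounded_vectors k cs =
     {v. length v = length cs \<and> (\<forall>i<length cs. 0 \<le> v ! i \<and> v ! i \<le> int (cs ! i)) \<and>
         (\<Sum>i<length cs. v ! i) = int k}"

definition vector_move :: "nat \<Rightarrow> nat \<Rightarrow> int list \<Rightarrow> int list \<Rightarrow> bool" where
  "vector_move i j v w \<longleftrightarrow>
     length v = length w \<and> i < length v \<and> j < length v \<and>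
     (\<forall>l<length v. l \<noteq> i \<and> l \<noteq> j \<longrightarrow> v ! l = w ! l) \<and>
     w ! i = v ! i - 1 \<and> w ! j = v ! j + 1"

definition vector_digraph :: "nat \<Rightarrow> 'a pair_pre_digraph \<Rightarrow> 'a set list \<Rightarrow> int list pair_pre_digraph" where
  "vector_digraph k D Cs =
    \<lparr> pverts = bounded_vectors k (map card Cs),
      parcs = {(v, w). v \<in> bounded_vectors k (map card Cs) \<and> w \<in> bounded_vectors k (map card Cs) \<and>
                 (\<exists>i j. i < j \<and> j < length Cs \<and> vector_move i j v w \<and>
                        (Cs ! i, Cs ! j) \<in> parcs (condensation D))} \<rparr>"

end

theory Submission
  imports Defs
begin

text \<open>
  A vertex of the token digraph is a placement of \<open>k\<close> tokens on vertices of \<open>D\<close>, and the vector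
  attached to it counts the tokens in each strong component of \<open>D\<close>.  Everything follows once this
  count is known to be a complete invariant of mutual reachability between placements.

  Equal counts imply mutual reachability.  Whenever \<open>x\<close> reaches \<open>y\<close> in \<open>D\<close>, a token on \<open>x\<close> can be
  traded for a token on a free vertex \<open>y\<close>, even if other tokens obstruct the walk: a token in the
  way continues the journey and the one behind it takes its place
  (\<open>token_reachable_exchange\<close>).  Two placements with equal counts are therefore joined by trades
  inside single components, each of which reduces the set difference
  (\<open>token_reachable_same_occupancy\<close>).

  Conversely, an arc of the token digraph either stays inside a component, and the count is
  unchanged, or goes from the \<open>i\<close>-th to the \<open>j\<close>-th component with \<open>i < j\<close>, and then it is a vector
  move.  A vector move with \<open>i < j\<close> raises the potential \<open>\<Sum>i. i * v\<^sub>i\<close>, so a change of count cannot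
  be undone (\<open>token_reachable_potential\<close>).  The same potential shows that the digraph of vectors is
  acyclic.

  A digraph with a complete invariant \<open>g\<close> of mutual reachability has the image of \<open>g\<close> as its
  condensation (\<open>condensation_iso_quotient\<close>).  It remains to see that every admissible vector and
  every admissible move comes from the token digraph.  Placements can be chosen componentwise, and
  for a move along an arc \<open>(x, y)\<close> of \<open>D\<close> the bounds on both vectors leave room to choose one that
  occupies \<open>x\<close> and avoids \<open>y\<close> (\<open>realize_occupancy\<close>, \<open>realize_vector_arc\<close>).
\<close>

section \<open>Strong components and their quotients\<close>

lemma strong_components_conv_scc_of:
  assumes "pair_wf_digraph G"
  shows "strong_components G = pre_digraph.scc_of (with_proj G) ` pverts G"
proof -
  interpret pair_wf_digraph G by fact
  show ?thesis
    unfolding strong_components_def sccs_verts_conv[symmetric]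
    by (auto simp: sccs_verts_conv_scc_of)
qed

text \<open>
  The strong components are the fibres of \<open>g\<close>, so sending a fibre to its common value identifies the
  condensation with the image of \<open>G\<close> under \<open>g\<close>, stripped of loops.  This reduces an isomorphism with
  a condensation to statements about single vertices and arcs of \<open>G\<close>.
\<close>

lemma condensation_iso_quotient:
  fixes g :: "'a \<Rightarrow> 'b"
  assumes wf: "pair_wf_digraph G"
    and inv: "\<And>x y. x \<in> pverts G \<Longrightarrow> y \<in> pverts G \<Longrightarrow>
      (x \<rightarrow>\<^sup>*\<^bsub>with_proj G\<^esub> y \<and> y \<rightarrow>\<^sup>*\<^bsub>with_proj G\<^esub> x) \<longleftrightarrow> g x = g y"
    and vertsH: "pverts H = g ` pverts G"
    and arcsH: "parcs H = {(g x, g y) | x y. (x, y) \<in> parcs G \<and> g x \<noteq> g y}"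
  shows "digraph_iso (with_proj (condensation G)) (with_proj H)"
proof -
  interpret pair_wf_digraph G by fact
  define fibre where "fibre x = {y \<in> pverts G. g y = g x}" for x
  have "scc_of x = fibre x" if x: "x \<in> pverts G" for x
  proof (intro set_eqI)
    fix y
    show "y \<in> scc_of x \<longleftrightarrow> y \<in> fibre x"
    proof (cases "y \<in> pverts G")
      case True
      then show ?thesis using inv[OF x True] by (auto simp: scc_of_def fibre_def)
    next
      case False
      then show ?thesis using reachable_in_verts(2)[of x y] by (auto simp: scc_of_def fibre_def)
    qed
  qed
  then have "scc_of ` pverts G = fibre ` pverts G" by (rule image_cong[OF refl])
  with strong_components_conv_scc_of[OF wf] have comps: "strong_components G = fibre ` pverts G"
    by (rule trans)
  define f where "f C = g (SOME x. x \<in> C)" for C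
  have f_fibre: "f (fibre x) = g x" if "x \<in> pverts G" for x
  proof -
    have "x \<in> fibre x" using that by (simp add: fibre_def)
    then have "(SOME y. y \<in> fibre x) \<in> fibre x" by (rule someI)
    moreover have "g y = g x" if "y \<in> fibre x" for y using that by (simp add: fibre_def)
    ultimately have "g (SOME y. y \<in> fibre x) = g x" by blast
    then show ?thesis by (simp only: f_def)
  qed
  have fibre_eq: "fibre x = fibre y \<longleftrightarrow> g x = g y" if "x \<in> pverts G" "y \<in> pverts G" for x y
    using that unfolding fibre_def by auto
  have inj: "inj_on f (strong_components G)"
    using f_fibre fibre_eq unfolding comps inj_on_def by simp
  have arcs: "parcs (condensation G) =
      {(fibre x, fibre y) | x y. (x, y) \<in> parcs G \<and> g x \<noteq> g y}" (is "?L = ?R")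
  proof (intro set_eqI iffI)
    fix e assume "e \<in> ?L"
    moreover obtain C C' where e: "e = (C, C')" by (cases e)
    ultimately have C: "C \<in> fibre ` pverts G" "C' \<in> fibre ` pverts G"
      and "C \<noteq> C'" "\<exists>x\<in>C. \<exists>y\<in>C'. (x, y) \<in> parcs G"
      unfolding condensation_def comps by simp_all
    then obtain x y where xy: "C \<noteq> C'" "x \<in> C" "y \<in> C'" "(x, y) \<in> parcs G" by blast
    from C obtain u v where "C = fibre u" "C' = fibre v" by blast
    with e xy have *: "e = (fibre u, fibre v)" "fibre u \<noteq> fibre v"
      "x \<in> fibre u" "y \<in> fibre v" "(x, y) \<in> parcs G" by blast+
    then have "fibre x = fibre u" "fibre y = fibre v" "g x \<noteq> g y"
      by (auto simp: fibre_def)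
    with * show "e \<in> ?R" by blast
  next
    fix e assume "e \<in> ?R"
    then obtain x y where *: "e = (fibre x, fibre y)" "(x, y) \<in> parcs G" "g x \<noteq> g y" by blast
    then have "x \<in> pverts G" "y \<in> pverts G" by (auto dest: in_arcsD1 in_arcsD2)
    moreover from this have "x \<in> fibre x" "y \<in> fibre y" by (auto simp: fibre_def)
    ultimately show "e \<in> ?L" using * fibre_eq by (auto simp: condensation_def comps)
  qed
  have parcs_sub: "parcs (condensation G) \<subseteq> strong_components G \<times> strong_components G"
    by (auto simp: condensation_def)
  define hom where "hom = \<lparr> iso_verts = f, iso_arcs = map_prod f f, iso_head = snd, iso_tail = fst \<rparr>"
  have "wf_digraph (with_proj (condensation G))"
    using parcs_sub by unfold_locales (auto simp: condensation_def)
  moreover have "inj_on (map_prod f f) (parcs (condensation G))"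
    using map_prod_inj_on[OF inj inj] parcs_sub by (rule inj_on_subset)
  ultimately have "pre_digraph.digraph_isomorphism (with_proj (condensation G)) hom"
    using inj unfolding pre_digraph.digraph_isomorphism_def
    by (simp add: hom_def condensation_def)
  moreover have "with_proj H = app_iso hom (with_proj (condensation G))"
  proof -
    have "f ` pverts (condensation G) = pverts H"
      using f_fibre by (simp add: condensation_def comps vertsH image_image)
    moreover have "map_prod f f ` parcs (condensation G) = parcs H"
    proof -
      have "parcs (condensation G) =
          (\<lambda>(x, y). (fibre x, fibre y)) ` {(x, y) \<in> parcs G. g x \<noteq> g y}"
        unfolding arcs by auto
      then have "map_prod f f ` parcs (condensation G) =
          (\<lambda>(x, y). (f (fibre x), f (fibre y))) ` {(x, y) \<in> parcs G. g x \<noteq> g y}"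
        by (simp add: image_image case_prod_beta)
      also have "\<dots> = (\<lambda>(x, y). (g x, g y)) ` {(x, y) \<in> parcs G. g x \<noteq> g y}"
        using f_fibre in_arcsD1 in_arcsD2 by (intro image_cong) auto
      also have "\<dots> = parcs H" unfolding arcsH by auto
      finally show ?thesis .
    qed
    ultimately show ?thesis by (simp add: with_proj_def app_iso_def hom_def)
  qed
  ultimately show ?thesis unfolding digraph_iso_def by blast
qed

section \<open>Moving tokens along walks\<close>

lemma token_digraph_arcI:
  assumes "A \<subseteq> pverts D" "B \<subseteq> pverts D" "card A = k" "card B = k"
    and "A - B = {a}" "B - A = {b}" "(a, b) \<in> parcs D"
  shows "(A, B) \<in> parcs (token_digraph k D)"
  using assms by (auto simp: token_digraph_def)

lemma pverts_token_digraph [simp]: "pverts (token_digraph k D) = {A. A \<subseteq> pverts D \<and> card A = k}"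
  by (simp add: token_digraph_def)

lemma pair_wf_digraph_token_digraph: "pair_wf_digraph (token_digraph k D)"
  by unfold_locales (auto simp: token_digraph_def)

context pair_digraph
begin

lemma card_exchange:
  assumes "A \<subseteq> pverts G" "x \<in> A" "y \<notin> A"
  shows "card (insert y (A - {x})) = card A"
proof -
  have "finite A" using assms(1) pair_finite_verts by (rule finite_subset)
  then have "card (insert y (A - {x})) = Suc (card (A - {x}))" using assms by simp
  also have "\<dots> = card A" using \<open>finite A\<close> \<open>x \<in> A\<close> by (rule card_Suc_Diff1)
  finally show ?thesis .
qed

lemma token_step:
  assumes "A \<subseteq> pverts G" "card A = k" "x \<in> A" "y \<notin> A" "(x, y) \<in> parcs G"
  shows "(A, insert y (A - {x})) \<in> parcs (token_digraph k G)"
  using assms card_exchange[of A x y] in_arcsD2[of x y]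
  by (intro token_digraph_arcI[where a = x and b = y]) auto

text \<open>
  Induction along the walk from \<open>x\<close> to \<open>y\<close>, for all placements \<open>A\<close> at once.  Let \<open>z\<close> be the vertex
  after \<open>x\<close>.  If \<open>z\<close> is free, the token steps from \<open>x\<close> to \<open>z\<close> and goes on from there.  If \<open>z\<close> is
  occupied, its token first travels to \<open>y\<close>, and then the token on \<open>x\<close> steps onto the vacated \<open>z\<close>.
\<close>

lemma token_reachable_exchange:
  assumes "x \<rightarrow>\<^sup>*\<^bsub>with_proj G\<^esub> y" "A \<subseteq> pverts G" "card A = k" "x \<in> A" "y \<notin> A"
  shows "A \<rightarrow>\<^sup>*\<^bsub>with_proj (token_digraph k G)\<^esub> insert y (A - {x})"
  using assms
proof (induction arbitrary: A rule: converse_reachable_induct)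
  case base
  then show ?case by simp
next
  case (step x z)
  interpret T: pair_wf_digraph "token_digraph k G" by (rule pair_wf_digraph_token_digraph)
  have y: "y \<in> pverts G" using step.hyps(2) by (rule reachable_in_verts)
  have z: "z \<in> pverts G" using step.hyps(1) by (rule in_arcsD2)
  show ?case
  proof (cases "z \<in> A")
    case False
    let ?A = "insert z (A - {x})"
    have first: "(A, ?A) \<in> parcs (token_digraph k G)"
      using step False by (intro token_step) auto
    show ?thesis
    proof (cases "z = y")
      case True
      then show ?thesis using first by auto
    next
      case neq: False
      have "?A \<rightarrow>\<^sup>*\<^bsub>with_proj (token_digraph k G)\<^esub> insert y (?A - {z})"
        using step False neq z card_exchange[of A x z] by (intro step.IH) auto
      moreover have "insert y (?A - {z}) = insert y (A - {x})" using False by auto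
      ultimately show ?thesis using first T.adj_reachable_trans by simp
    qed
  next
    case True
    let ?A = "insert y (A - {z})"
    have first: "A \<rightarrow>\<^sup>*\<^bsub>with_proj (token_digraph k G)\<^esub> ?A"
      using step True by (intro step.IH) auto
    have "x \<noteq> z" using step.hyps(1) pair_no_loops by fastforce
    then have "(?A, insert z (?A - {x})) \<in> parcs (token_digraph k G)"
      using step True y card_exchange[of A z y] by (intro token_step) auto
    moreover have "insert z (?A - {x}) = insert y (A - {x})"
      using True \<open>x \<noteq> z\<close> step.prems by auto
    ultimately show ?thesis using first T.reachable_adj_trans by simp
  qed
qed

end

section \<open>Occupancy vectors\<close>

definition occupancy :: "'a set list \<Rightarrow> 'a set \<Rightarrow> int list" where
  "occupancy Cs A = map (\<lambda>C. int (card (A \<inter> C))) Cs"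

lemma length_occupancy [simp]: "length (occupancy Cs A) = length Cs"
  by (simp add: occupancy_def)

lemma nth_occupancy [simp]: "i < length Cs \<Longrightarrow> occupancy Cs A ! i = int (card (A \<inter> Cs ! i))"
  by (simp add: occupancy_def)

text \<open>
  Placing weight \<open>i\<close> on the \<open>i\<close>-th component turns the topological order into a single number that
  grows whenever a token leaves its component.
\<close>

definition potential :: "int list \<Rightarrow> int" where
  "potential v = (\<Sum>i<length v. int i * v ! i)"

lemma potential_vector_move:
  assumes "vector_move i j v w" "i < j"
  shows "potential v < potential w"
proof -
  from assms have len: "length v = length w" and ij: "i < length v" "j < length v"
    and others: "\<And>l. l < length v \<Longrightarrow> l \<noteq> i \<Longrightarrow> l \<noteq> j \<Longrightarrow> v ! l = w ! l"
    and wi: "w ! i = v ! i - 1" and wj: "w ! j = v ! j + 1"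
    by (auto simp: vector_move_def)
  have "potential w - potential v = (\<Sum>l<length v. int l * (w ! l - v ! l))"
    by (simp add: potential_def len sum_subtractf right_diff_distrib)
  also have "\<dots> = (\<Sum>l\<in>{i, j}. int l * (w ! l - v ! l))"
    using ij others by (intro sum.mono_neutral_right) auto
  also have "\<dots> = int j - int i" using assms(2) wi wj by simp
  finally show ?thesis using assms(2) by simp
qed

lemma acyclic_vector_digraph: "acyclic (parcs (vector_digraph k D Cs))"
proof -
  have "potential v < potential w" if "(v, w) \<in> (parcs (vector_digraph k D Cs))\<^sup>+" for v w
    using that
    by (induction rule: trancl_induct)
       (auto simp: vector_digraph_def intro: potential_vector_move less_trans)
  then show ?thesis unfolding acyclic_def by blast
qed

locale ordered_components = pair_digraph D for D :: "'a pair_pre_digraph" +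
  fixes Cs :: "'a set list"
  assumes topological: "topological_order D Cs"
begin

lemma set_Cs: "set Cs = scc_of ` pverts D"
  using topological strong_components_conv_scc_of[OF pair_wf_digraph_axioms]
  by (simp add: topological_order_def)

lemma component_subset: "i < length Cs \<Longrightarrow> Cs ! i \<subseteq> pverts D"
  using nth_mem[of i Cs] unfolding set_Cs scc_of_def by (auto dest: reachable_in_verts)

lemma finite_component: "i < length Cs \<Longrightarrow> finite (Cs ! i)"
  using component_subset pair_finite_verts by (rule finite_subset)

lemma component_eqI:
  assumes "i < length Cs" "j < length Cs" "x \<in> Cs ! i" "x \<in> Cs ! j"
  shows "i = j"
proof -
  from assms have "Cs ! i \<in> set Cs" "Cs ! j \<in> set Cs" by auto
  with assms have "Cs ! i = scc_of x" "Cs ! j = scc_of x"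
    unfolding set_Cs using scc_of_eq by auto
  moreover have "distinct Cs" using topological by (simp add: topological_order_def)
  ultimately show ?thesis using assms(1,2) nth_eq_iff_index_eq by metis
qed

lemma obtain_component:
  assumes "x \<in> pverts D"
  obtains i where "i < length Cs" "x \<in> Cs ! i"
proof -
  have "scc_of x \<in> set Cs" using assms set_Cs by blast
  then show ?thesis using that in_scc_of_self[OF assms] by (metis in_set_conv_nth)
qed

lemma Union_components: "(\<Union>i<length Cs. Cs ! i) = pverts D"
proof
  show "(\<Union>i<length Cs. Cs ! i) \<subseteq> pverts D" using component_subset by blast
  show "pverts D \<subseteq> (\<Union>i<length Cs. Cs ! i)"
  proof
    fix x assume "x \<in> pverts D"
    then obtain i where "i < length Cs" "x \<in> Cs ! i" by (rule obtain_component)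
    then show "x \<in> (\<Union>i<length Cs. Cs ! i)" by blast
  qed
qed

lemma component_reachable:
  assumes "i < length Cs" "x \<in> Cs ! i" "y \<in> Cs ! i"
  shows "x \<rightarrow>\<^sup>*\<^bsub>with_proj D\<^esub> y"
proof -
  have "Cs ! i \<in> set Cs" using assms by simp
  then show ?thesis
    using assms unfolding set_Cs scc_of_def by (auto intro: reachable_trans)
qed

lemma condensation_arcI:
  assumes "(x, y) \<in> parcs D" "i < length Cs" "j < length Cs" "x \<in> Cs ! i" "y \<in> Cs ! j" "i \<noteq> j"
  shows "(Cs ! i, Cs ! j) \<in> parcs (condensation D)"
proof -
  have "distinct Cs" "set Cs = strong_components D"
    using topological by (auto simp: topological_order_def)
  moreover from this have "Cs ! i \<noteq> Cs ! j" using assms by (simp add: nth_eq_iff_index_eq)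
  ultimately show ?thesis
    unfolding condensation_def using assms nth_mem[of i Cs] nth_mem[of j Cs] by auto
qed

lemma condensation_arc_less:
  assumes "(Cs ! i, Cs ! j) \<in> parcs (condensation D)" "i < length Cs" "j < length Cs"
  shows "i < j"
proof -
  obtain i' j' where "i' < j'" "j' < length Cs" "Cs ! i = Cs ! i'" "Cs ! j = Cs ! j'"
    using assms(1) topological by (auto simp: topological_order_def)
  moreover have "distinct Cs" using topological by (simp add: topological_order_def)
  ultimately have "i = i'" "j = j'"
    using assms(2,3) nth_eq_iff_index_eq[of Cs] by (meson less_trans)+
  with \<open>i' < j'\<close> show ?thesis by simp
qed

lemma card_eq_sum_components:
  assumes "A \<subseteq> pverts D"
  shows "card A = (\<Sum>i<length Cs. card (A \<inter> Cs ! i))"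
proof -
  have "A = (\<Union>i<length Cs. A \<inter> Cs ! i)"
    using assms Union_components by blast
  then have "card A = card (\<Union>i\<in>{..<length Cs}. A \<inter> Cs ! i)" by simp
  also have "\<dots> = (\<Sum>i<length Cs. card (A \<inter> Cs ! i))"
    
  proof (rule card_UN_disjoint)
    show "\<forall>i\<in>{..<length Cs}. finite (A \<inter> Cs ! i)" by (simp add: finite_component)
    show "\<forall>i\<in>{..<length Cs}. \<forall>j\<in>{..<length Cs}. i \<noteq> j \<longrightarrow> (A \<inter> Cs ! i) \<inter> (A \<inter> Cs ! j) = {}"
      using component_eqI by blast
  qed simp
  finally show ?thesis .
qed

lemma occupancy_in_bounded_vectors:
  assumes "A \<subseteq> pverts D" "card A = k"
  shows "occupancy Cs A \<in> bounded_vectors k (map card Cs)"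
proof -
  have "card (A \<inter> Cs ! i) \<le> card (Cs ! i)" if "i < length Cs" for i
    using finite_component[OF that] by (intro card_mono) auto
  moreover have "(\<Sum>i<length Cs. int (card (A \<inter> Cs ! i))) = int k"
    using card_eq_sum_components[OF assms(1)] assms(2) by simp
  ultimately show ?thesis by (simp add: bounded_vectors_def)
qed

text \<open>
  Since the components partition the vertex set, a placement with prescribed counts is a union of
  independent choices, one in each component.  The sets \<open>X\<close> of vertices to be occupied and \<open>Y\<close> of
  vertices to be left free are only constrained componentwise.
\<close>

lemma realize_occupancy:
  assumes v: "v \<in> bounded_vectors k (map card Cs)"
    and lower: "\<And>i. i < length Cs \<Longrightarrow> int (card (Cs ! i \<inter> X)) \<le> v ! i"
    and upper: "\<And>i. i < length Cs \<Longrightarrow> v ! i \<le> int (card (Cs ! i - Y))"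
    and XY: "X \<inter> Y = {}" "X \<subseteq> pverts D"
  obtains A where "A \<subseteq> pverts D" "card A = k" "occupancy Cs A = v" "X \<subseteq> A" "A \<inter> Y = {}"
proof -
  have "\<exists>S. Cs ! i \<inter> X \<subseteq> S \<and> S \<subseteq> Cs ! i - Y \<and> card S = nat (v ! i)" if "i < length Cs" for i
    using exists_subset_between[of "Cs ! i \<inter> X" "nat (v ! i)" "Cs ! i - Y"]
      lower[OF that] upper[OF that] XY(1) finite_component[OF that] by fastforce
  then obtain S where S: "\<And>i. i < length Cs \<Longrightarrow>
      Cs ! i \<inter> X \<subseteq> S i \<and> S i \<subseteq> Cs ! i - Y \<and> card (S i) = nat (v ! i)" by metis
  define A where "A = (\<Union>i<length Cs. S i)"
  have A: "A \<subseteq> pverts D" using S component_subset unfolding A_def by fastforce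
  have "A \<inter> Cs ! i = S i" if "i < length Cs" for i
    using S that component_eqI unfolding A_def by blast
  moreover have nonneg: "length v = length Cs" "\<And>i. i < length Cs \<Longrightarrow> 0 \<le> v ! i"
      "(\<Sum>i<length Cs. v ! i) = int k"
    using v by (auto simp: bounded_vectors_def)
  ultimately have "occupancy Cs A ! i = v ! i" if "i < length Cs" for i
    using S[OF that] that by simp
  then have occ: "occupancy Cs A = v" using nonneg(1) by (intro nth_equalityI) auto
  have "int (card A) = (\<Sum>i<length Cs. occupancy Cs A ! i)"
    by (simp add: card_eq_sum_components[OF A])
  then have "card A = k" unfolding occ nonneg(3) by simp
  moreover have "X \<subseteq> A"
  proof
    fix x assume "x \<in> X"
    moreover from this XY(2) obtain i where "i < length Cs" "x \<in> Cs ! i"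
      by (meson obtain_component subsetD)
    ultimately show "x \<in> A" using S[of i] unfolding A_def by blast
  qed
  moreover have "A \<inter> Y = {}" using S unfolding A_def by blast
  ultimately show ?thesis using A occ that by blast
qed

lemma card_inter_component_exchange:
  assumes A: "A \<subseteq> pverts D" and x: "x \<in> A" "i < length Cs" "x \<in> Cs ! i"
    and y: "y \<notin> A" "j < length Cs" "y \<in> Cs ! j" and l: "l < length Cs"
  shows "int (card (insert y (A - {x}) \<inter> Cs ! l)) =
    int (card (A \<inter> Cs ! l)) - of_bool (l = i) + of_bool (l = j)"
proof -
  have fin: "finite (A \<inter> Cs ! l)" using finite_component[OF l] by simp
  have x_iff: "x \<in> Cs ! l \<longleftrightarrow> l = i" and y_iff: "y \<in> Cs ! l \<longleftrightarrow> l = j"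
    using x y l component_eqI by blast+
  have removed: "int (card (A \<inter> Cs ! l - {x})) = int (card (A \<inter> Cs ! l)) - of_bool (l = i)"
  proof (cases "l = i")
    case True
    then have "x \<in> A \<inter> Cs ! l" using x by simp
    from card_Suc_Diff1[OF fin this] show ?thesis using True by simp
  next
    case False
    then have "A \<inter> Cs ! l - {x} = A \<inter> Cs ! l" using x_iff by blast
    then show ?thesis using False by simp
  qed
  have "int (card (insert y (A - {x}) \<inter> Cs ! l)) =
      int (card (A \<inter> Cs ! l - {x})) + of_bool (l = j)"
  proof (cases "l = j")
    case True
    then have "insert y (A - {x}) \<inter> Cs ! l = insert y (A \<inter> Cs ! l - {x})" using y_iff by blast
    then show ?thesis using True fin y(1) by simp
  next
    case False
    then have "insert y (A - {x}) \<inter> Cs ! l = A \<inter> Cs ! l - {x}" using y_iff by blast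
    then show ?thesis using False by simp
  qed
  with removed show ?thesis by simp
qed

lemma occupancy_exchange_same:
  assumes "A \<subseteq> pverts D" "x \<in> A" "y \<notin> A" "i < length Cs" "x \<in> Cs ! i" "y \<in> Cs ! i"
  shows "occupancy Cs (insert y (A - {x})) = occupancy Cs A"
  using card_inter_component_exchange[OF assms(1,2,4,5,3,4,6)]
  by (intro nth_equalityI) auto

lemma occupancy_exchange_move:
  assumes "A \<subseteq> pverts D" "x \<in> A" "y \<notin> A" "i < length Cs" "x \<in> Cs ! i"
    "j < length Cs" "y \<in> Cs ! j" "i \<noteq> j"
  shows "vector_move i j (occupancy Cs A) (occupancy Cs (insert y (A - {x})))"
proof -
  define B where "B = insert y (A - {x})"
  have "int (card (B \<inter> Cs ! l)) =
      int (card (A \<inter> Cs ! l)) - of_bool (l = i) + of_bool (l = j)" if "l < length Cs" for l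
    unfolding B_def using card_inter_component_exchange[OF assms(1,2,4,5,3,6,7) that] .
  then show ?thesis
    using assms(4,6,8) unfolding vector_move_def B_def[symmetric] by simp
qed

lemma vector_move_target_unique:
  assumes "vector_move i j v w" "vector_move i j v w'" "i \<noteq> j"
  shows "w = w'"
  using assms unfolding vector_move_def by (metis nth_equalityI)

section \<open>The strong components and arcs of the token digraph\<close>

lemma token_arc_cases:
  assumes "(A, B) \<in> parcs (token_digraph k D)"
  obtains (same) "occupancy Cs A = occupancy Cs B"
  | (move) i j where "i < j" "j < length Cs" "vector_move i j (occupancy Cs A) (occupancy Cs B)"
      "(Cs ! i, Cs ! j) \<in> parcs (condensation D)"
proof -
  from assms obtain a b where A: "A \<subseteq> pverts D" and ab: "A - B = {a}" "B - A = {b}"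
    and arc: "(a, b) \<in> parcs D" by (auto simp: token_digraph_def)
  have B: "B = insert b (A - {a})" and a: "a \<in> A" and b: "b \<notin> A" using ab by auto
  obtain i where i: "i < length Cs" "a \<in> Cs ! i" using arc by (meson in_arcsD1 obtain_component)
  obtain j where j: "j < length Cs" "b \<in> Cs ! j" using arc by (meson in_arcsD2 obtain_component)
  show ?thesis
  proof (cases "i = j")
    case True
    then show ?thesis using same occupancy_exchange_same[OF A a b i] j B by simp
  next
    case False
    have "(Cs ! i, Cs ! j) \<in> parcs (condensation D)"
      using condensation_arcI[OF arc i(1) j(1) i(2) j(2) False] .
    moreover from this have "i < j" using condensation_arc_less i j by blast
    ultimately show ?thesis using move j occupancy_exchange_move[OF A a b i j False] B by simp
  qed
qed

text \<open>
  Tokens that leave a component never return: along a walk the potential is nondecreasing, and it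
  stays constant only if the counts do.  In particular, mutually reachable placements have the same
  occupancy.
\<close>

lemma token_reachable_potential:
  assumes "A \<rightarrow>\<^sup>*\<^bsub>with_proj (token_digraph k D)\<^esub> B"
  shows "occupancy Cs A = occupancy Cs B \<or>
    potential (occupancy Cs A) < potential (occupancy Cs B)"
proof -
  interpret T: pair_wf_digraph "token_digraph k D" by (rule pair_wf_digraph_token_digraph)
  show ?thesis
    using assms
  proof (induction rule: T.reachable_induct)
    case base
    then show ?case by simp
  next
    case (step X Y)
    from step.hyps(2) show ?case
    proof (cases rule: token_arc_cases)
      case same
      then show ?thesis using step.IH by simp
    next
      case (move i j)
      then show ?thesis using step.IH potential_vector_move[of i j] by fastforce
    qed
  qed
qed

text \<open>
  If \<open>A\<close> has a vertex \<open>x\<close> outside \<open>B\<close>, then equality of the counts in the component of \<open>x\<close> provides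
  a vertex \<open>y\<close> of \<open>B\<close> outside \<open>A\<close> in the same component.  Trading \<open>x\<close> for \<open>y\<close> preserves the counts
  and brings \<open>A\<close> closer to \<open>B\<close>.
\<close>

lemma token_reachable_same_occupancy:
  assumes "A \<subseteq> pverts D" "B \<subseteq> pverts D" "card A = k" "occupancy Cs A = occupancy Cs B"
  shows "A \<rightarrow>\<^sup>*\<^bsub>with_proj (token_digraph k D)\<^esub> B"
  using assms
proof (induction "card (A - B)" arbitrary: A rule: less_induct)
  case less
  interpret T: pair_wf_digraph "token_digraph k D" by (rule pair_wf_digraph_token_digraph)
  have finA: "finite A" and finB: "finite B"
    using less.prems pair_finite_verts by (auto intro: finite_subset)
  have same: "card (A \<inter> Cs ! i) = card (B \<inter> Cs ! i)" if "i < length Cs" for i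
    using arg_cong[OF less.prems(4), of "\<lambda>v. v ! i"] that by simp
  then have card: "card A = card B"
    using card_eq_sum_components less.prems by simp
  show ?case
  proof (cases "A \<subseteq> B")
    case True
    then have "A = B" using card_subset_eq[OF finB] card by simp
    moreover have "B \<in> pverts (token_digraph k D)"
      using less.prems card by (simp add: token_digraph_def)
    ultimately show ?thesis by simp
  next
    case False
    then obtain x where x: "x \<in> A" "x \<notin> B" by blast
    then obtain i where i: "i < length Cs" "x \<in> Cs ! i"
      using less.prems(1) by (meson obtain_component subsetD)
    have "\<not> B \<inter> Cs ! i \<subseteq> A \<inter> Cs ! i"
      using card_subset_eq[of "A \<inter> Cs ! i" "B \<inter> Cs ! i"] same[OF i(1)] finA x i by auto
    then obtain y where y: "y \<in> B" "y \<in> Cs ! i" "y \<notin> A" by blast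
    let ?A = "insert y (A - {x})"
    have "A \<rightarrow>\<^sup>*\<^bsub>with_proj (token_digraph k D)\<^esub> ?A"
      using less.prems x y i by (intro token_reachable_exchange component_reachable) auto
    also have "?A \<rightarrow>\<^sup>*\<^bsub>with_proj (token_digraph k D)\<^esub> B"
    proof (rule less.hyps)
      have "?A - B = (A - B) - {x}" using y by auto
      moreover have "card ((A - B) - {x}) < card (A - B)"
        using finA x by (intro card_Diff1_less) auto
      ultimately show "card (?A - B) < card (A - B)" by simp
    qed (use less.prems x y i card_exchange[of A x y] occupancy_exchange_same[of A x y i] in auto)
    finally show ?thesis .
  qed
qed

lemma mutually_reachable_iff_same_occupancy:
  assumes "A \<in> pverts (token_digraph k D)" "B \<in> pverts (token_digraph k D)"
  shows "(A \<rightarrow>\<^sup>*\<^bsub>with_proj (token_digraph k D)\<^esub> B \<and> B \<rightarrow>\<^sup>*\<^bsub>with_proj (token_digraph k D)\<^esub> A)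
    \<longleftrightarrow> occupancy Cs A = occupancy Cs B"
  using assms token_reachable_potential[of k A B] token_reachable_potential[of k B A]
    token_reachable_same_occupancy[of A B k] token_reachable_same_occupancy[of B A k]
  by auto

lemma pverts_vector_digraph_eq:
  "pverts (vector_digraph k D Cs) = occupancy Cs ` pverts (token_digraph k D)"
proof (intro set_eqI iffI)
  fix v assume "v \<in> pverts (vector_digraph k D Cs)"
  then have v: "v \<in> bounded_vectors k (map card Cs)" by (simp add: vector_digraph_def)
  then obtain A where "A \<subseteq> pverts D" "card A = k" "occupancy Cs A = v"
    by (rule realize_occupancy[where X = "{}" and Y = "{}"]) (use v in \<open>auto simp: bounded_vectors_def\<close>)
  then show "v \<in> occupancy Cs ` pverts (token_digraph k D)" by (auto simp: token_digraph_def)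
qed (auto simp: token_digraph_def vector_digraph_def occupancy_in_bounded_vectors)

text \<open>
  Let the move be carried by an arc \<open>(x, y)\<close> of \<open>D\<close>.  Nonnegativity of \<open>w\<close> at \<open>i\<close> forces a token in
  the \<open>i\<close>-th component before the move, and the upper bound on \<open>w\<close> at \<open>j\<close> forces a free vertex in the
  \<open>j\<close>-th one; so some placement realizing \<open>v\<close> occupies \<open>x\<close> and leaves \<open>y\<close> free.
\<close>

lemma realize_vector_arc:
  assumes "(v, w) \<in> parcs (vector_digraph k D Cs)"
  obtains A B where "(A, B) \<in> parcs (token_digraph k D)" "occupancy Cs A = v" "occupancy Cs B = w"
    "v \<noteq> w"
proof -
  from assms obtain i j where v: "v \<in> bounded_vectors k (map card Cs)"
    and w: "w \<in> bounded_vectors k (map card Cs)"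
    and ij: "i < j" "j < length Cs" and mv: "vector_move i j v w"
    and "(Cs ! i, Cs ! j) \<in> parcs (condensation D)"
    by (auto simp: vector_digraph_def)
  then obtain x y where x: "x \<in> Cs ! i" and y: "y \<in> Cs ! j" and arc: "(x, y) \<in> parcs D"
    by (auto simp: condensation_def)
  have i: "i < length Cs" using ij by simp
  have v_bounds: "0 \<le> v ! l" "v ! l \<le> int (card (Cs ! l))" if "l < length Cs" for l
    using v that by (auto simp: bounded_vectors_def)
  have "0 \<le> w ! i" "w ! j \<le> int (card (Cs ! j))"
    using w i ij(2) by (auto simp: bounded_vectors_def)
  then have vi: "1 \<le> v ! i" and vj: "v ! j < int (card (Cs ! j))"
    using mv by (auto simp: vector_move_def)
  obtain A where A: "A \<subseteq> pverts D" "card A = k" "occupancy Cs A = v" "{x} \<subseteq> A" "A \<inter> {y} = {}"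
  proof (rule realize_occupancy[OF v, where X = "{x}" and Y = "{y}"])
    fix l assume l: "l < length Cs"
    show "int (card (Cs ! l \<inter> {x})) \<le> v ! l"
    proof (cases "l = i")
      case True
      then show ?thesis using vi x by simp
    next
      case False
      then have "x \<notin> Cs ! l" using component_eqI i l x by blast
      then show ?thesis using v_bounds[OF l] by simp
    qed
    show "v ! l \<le> int (card (Cs ! l - {y}))"
    proof (cases "l = j")
      case True
      then show ?thesis using vj card_Suc_Diff1[OF finite_component[OF l], of y] y by simp
    next
      case False
      then have "y \<notin> Cs ! l" using component_eqI ij l y by blast
      then show ?thesis using v_bounds[OF l] by simp
    qed
  next
    show "{x} \<inter> {y} = {}" using component_eqI[OF i ij(2) x] ij(1) y by auto
    show "{x} \<subseteq> pverts D" using in_arcsD1[OF arc] by simp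
  qed
  let ?B = "insert y (A - {x})"
  have "(A, ?B) \<in> parcs (token_digraph k D)" using A arc by (intro token_step) auto
  moreover have "vector_move i j v (occupancy Cs ?B)"
    using occupancy_exchange_move[of A x y i j] A i ij x y by auto
  then have "occupancy Cs ?B = w" using vector_move_target_unique mv ij by blast
  moreover have "v \<noteq> w" using potential_vector_move[OF mv ij(1)] by auto
  ultimately show ?thesis using that A(3) by blast
qed

lemma parcs_vector_digraph_eq:
  "parcs (vector_digraph k D Cs) =
    {(occupancy Cs A, occupancy Cs B) | A B.
      (A, B) \<in> parcs (token_digraph k D) \<and> occupancy Cs A \<noteq> occupancy Cs B}" (is "?L = ?R")
proof (intro set_eqI iffI)
  fix e assume "e \<in> ?L"
  then show "e \<in> ?R" by (cases e) (blast elim: realize_vector_arc)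
next
  fix e assume "e \<in> ?R"
  then obtain A B where e: "e = (occupancy Cs A, occupancy Cs B)"
    and arc: "(A, B) \<in> parcs (token_digraph k D)"
    and neq: "occupancy Cs A \<noteq> occupancy Cs B" by blast
  have "occupancy Cs A \<in> bounded_vectors k (map card Cs)"
    "occupancy Cs B \<in> bounded_vectors k (map card Cs)"
    using arc by (auto simp: token_digraph_def intro!: occupancy_in_bounded_vectors)
  then show "e \<in> ?L"
    using arc neq e by (elim token_arc_cases) (auto simp: vector_digraph_def)
qed

end

theorem theorem3p1:
  fixes D :: "'a pair_pre_digraph" and n k :: nat and Cs :: "'a set list"
  assumes "pair_digraph D"
    and "card (pverts D) = n"
    and "1 \<le> k" and "k \<le> n - 1"
    and "topological_order D Cs"
  shows "acyclic (parcs (vector_digraph k D Cs)) \<and>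
         digraph_iso (with_proj (condensation (token_digraph k D))) (with_proj (vector_digraph k D Cs))"
proof
  interpret pair_digraph D by fact
  interpret ordered_components D Cs by unfold_locales fact
  show "acyclic (parcs (vector_digraph k D Cs))" by (rule acyclic_vector_digraph)
  show "digraph_iso (with_proj (condensation (token_digraph k D))) (with_proj (vector_digraph k D Cs))"
    using pair_wf_digraph_token_digraph mutually_reachable_iff_same_occupancy
      pverts_vector_digraph_eq parcs_vector_digraph_eq
    by (rule condensation_iso_quotient)
qed

end
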